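(* Let $\lambda$ be a partition and $k\ge0$ an integer. If $q\ge2$ is an integer, then $\mathbf S_\lambda(1,t,\ldots,t^k)$ is a polynomial in $t$ with nonnegative coefficients.
   Context: Let $\hat{\mathbb Q}(\mathbf t)$ be the field of rational functions over $\mathbb Q$ in algebraically independent indeterminates $t^{q^r}$, $r\in\mathbb Z$ ($t=t^{q^0}$), with automorphism $\varphi:t^{q^r}\mapsto t^{q^{r+1}}$. For a partition $\lambda=(\lambda_1\ge\cdots\ge\lambda_{N}\ge0)$ with at most $N=k+1$ parts, $$\mathbf S_\lambda(1,t,\ldots,t^{k}):=\frac{\det\big((t^{q^{\lambda_j+N-j}})^{i-1}\big)_{i,j=1}^{N}}{\det\big((t^{q^{N-j}})^{i-1}\big)_{i,j=1}^{N}}\in\hat{\mathbb Q}(\mathbf t).$$ With $\mathbf H_r(1,\ldots,t^k):=\mathbf S_{(r,0,\ldots,0)}(1,\ldots,t^k)$ for $r\ge0$ and $\mathbf H_r:=0$ for $r<0$, for a partition $\lambda=(\lambda_1,\ldots,\lambda_\ell)$ with any number of parts one has the definition $\mathbf S_\lambda(1,t,\ldots,t^k):=\det\big(\varphi^{1-j}\mathbf H_{\lambda_i-i+j}(1,t,\ldots,t^k)\big)_{i,j=1}^\ell$, which agrees with the quotient above when $\lambda$ has at most $k+1$ parts. For an integer $q\ge2$, these elements are specialized by interpreting $t^{q^r}$ as the actual $q^r$-th power of the variable $t$ in $\bigcup_{r\ge0}\mathbb Q(t^{q^{-r}})$; the claim is that the result lies in $\mathbb Z_{\ge0}[t]$.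 *)

theory Defs
  imports
    "HOL-Library.Poly_Mapping"
    "HOL-Computational_Algebra.Fraction_Field"
    "HOL-Computational_Algebra.Polynomial"
    "Jordan_Normal_Form.Determinant"
begin

text \<open>
  \<open>push h\<close> relabels exponents along \<open>h\<close>: it sends \<open>\<Sum>\<^sub>m a\<^sub>m X\<^sup>m\<close> to \<open>\<Sum>\<^sub>m a\<^sub>m X\<^bsup>h m\<^esup>\<close>
  (coefficients of exponents identified by \<open>h\<close> are added).
\<close>

definition push :: "('a \<Rightarrow> 'b) \<Rightarrow> ('a \<Rightarrow>\<^sub>0 'c) \<Rightarrow> ('b \<Rightarrow>\<^sub>0 'c::comm_monoid_add)" where
  "push h f = (\<Sum>m\<in>Poly_Mapping.keys f. Poly_Mapping.single (h m) (Poly_Mapping.lookup f m))"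

lemma push_superset:
  assumes "finite A" "Poly_Mapping.keys f \<subseteq> A"
  shows "push h f = (\<Sum>m\<in>A. Poly_Mapping.single (h m) (Poly_Mapping.lookup f m))"
  unfolding push_def using assms
  by (intro sum.mono_neutral_left) (auto simp: in_keys_iff)

lemma push_zero [simp]: "push h 0 = 0"
  by (simp add: push_def)

lemma push_add: "push h (f + g) = push h f + push h g"
proof -
  let ?A = "Poly_Mapping.keys f \<union> Poly_Mapping.keys g"
  have "finite ?A" "Poly_Mapping.keys f \<subseteq> ?A" "Poly_Mapping.keys g \<subseteq> ?A" "Poly_Mapping.keys (f + g) \<subseteq> ?A"
    using Poly_Mapping.keys_add[of f g] by auto
  then show ?thesis
    by (simp add: push_superset[where A = "?A"] lookup_add single_add sum.distrib)
qed

lemma push_single [simp]: "push h (Poly_Mapping.single m a) = Poly_Mapping.single (h m) a"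
  by (subst push_superset[where A = "{m}"]) (auto simp: keys_single)

lemma push_sum: "push h (sum f A) = (\<Sum>x\<in>A. push h (f x))"
  by (induction A rule: infinite_finite_induct) (simp_all add: push_add)

lemma pm_as_sum: "f = (\<Sum>m\<in>Poly_Mapping.keys f. Poly_Mapping.single m (Poly_Mapping.lookup f m))"
  for f :: "'a \<Rightarrow>\<^sub>0 'c::comm_monoid_add"
  by (rule poly_mapping_eqI) (auto simp: lookup_sum lookup_single when_def in_keys_iff)

lemma push_push: "push g (push h f) = push (\<lambda>m. g (h m)) f"
  by (simp add: push_def[of h f] push_sum push_def[of "\<lambda>m. g (h m)"])

lemma push_id [simp]: "push (\<lambda>m. m) f = f"
  unfolding push_def by (rule pm_as_sum[symmetric])

lemma push_one: "h 0 = 0 \<Longrightarrow> push h 1 = 1"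
  using push_single[of h 0 1] by (simp add: single_one[symmetric] del: single_one)

lemma push_mult:
  fixes f g :: "'a::monoid_add \<Rightarrow>\<^sub>0 'c::semiring_0" and h :: "'a \<Rightarrow> 'b::monoid_add"
  assumes h: "\<And>m n. h (m + n) = h m + h n"
  shows "push h (f * g) = push h f * push h g"
proof -
  have "f * g = (\<Sum>m\<in>Poly_Mapping.keys f. \<Sum>n\<in>Poly_Mapping.keys g.
          Poly_Mapping.single (m + n) (Poly_Mapping.lookup f m * Poly_Mapping.lookup g n))"
    by (subst (1) pm_as_sum[of f], subst (1) pm_as_sum[of g])
      (simp add: sum_product mult_single)
  then show ?thesis
    by (simp add: push_sum h) (simp add: push_def sum_product mult_single)
qed

text \<open>
  The indeterminate \<open>t\<^bsup>q^r\<^esup>\<close> is the variable with index \<open>r :: int\<close>; at this level \<open>q\<close> is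
  purely formal.  A monomial is a finitely supported map from indices to exponents.
\<close>

type_synonym monom_Z = "int \<Rightarrow>\<^sub>0 nat"
type_synonym poly_Z = "monom_Z \<Rightarrow>\<^sub>0 rat"
type_synonym Qhat = "poly_Z fract"

definition tq :: "int \<Rightarrow> Qhat" where
  "tq r = Fract (Poly_Mapping.single (Poly_Mapping.single r 1) 1) 1"

definition shift_poly :: "int \<Rightarrow> poly_Z \<Rightarrow> poly_Z" where
  "shift_poly n = push (push (\<lambda>r. r + n))"

lemma shift_poly_add: "shift_poly n (f + g) = shift_poly n f + shift_poly n g"
  by (simp add: shift_poly_def push_add)

lemma shift_poly_mult: "shift_poly n (f * g) = shift_poly n f * shift_poly n g"
  by (simp add: shift_poly_def push_mult push_add)

lemma shift_poly_0 [simp]: "shift_poly n 0 = 0"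
  and shift_poly_1 [simp]: "shift_poly n 1 = 1"
  by (simp_all add: shift_poly_def push_one)

lemma shift_poly_shift_poly: "shift_poly m (shift_poly n f) = shift_poly (n + m) f"
  by (simp add: shift_poly_def push_push add.assoc)

lemma shift_poly_id [simp]: "shift_poly 0 f = f"
proof -
  have "push (\<lambda>r. r) = (\<lambda>m::monom_Z. m)"
    by (rule ext) simp
  then show ?thesis
    by (simp add: shift_poly_def)
qed

lemma shift_poly_eq_0_iff [simp]: "shift_poly n f = 0 \<longleftrightarrow> f = 0"
  using shift_poly_shift_poly[of "- n" n f] by auto

text \<open>\<open>phi n\<close> is the \<open>n\<close>-th power of the automorphism \<open>t\<^bsup>q^r\<^esup> \<mapsto> t\<^bsup>q^(r+1)\<^esup>\<close>, for any integer \<open>n\<close>.\<close>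

definition phi :: "int \<Rightarrow> Qhat \<Rightarrow> Qhat" where
  "phi n x = (THE y. \<exists>a b. b \<noteq> 0 \<and> x = Fract a b \<and> y = Fract (shift_poly n a) (shift_poly n b))"

lemma phi_Fract:
  assumes "b \<noteq> 0"
  shows "phi n (Fract a b) = Fract (shift_poly n a) (shift_poly n b)"
  unfolding phi_def
proof (rule the_equality)
  fix y
  assume "\<exists>c d. d \<noteq> 0 \<and> Fract a b = Fract c d \<and> y = Fract (shift_poly n c) (shift_poly n d)"
  then obtain c d where cd: "d \<noteq> 0" "Fract a b = Fract c d"
      "y = Fract (shift_poly n c) (shift_poly n d)"
    by blast
  from cd(1,2) assms have "a * d = c * b"
    by (simp add: eq_fract)
  then have "shift_poly n a * shift_poly n d = shift_poly n c * shift_poly n b"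
    by (metis shift_poly_mult)
  with cd assms show "y = Fract (shift_poly n a) (shift_poly n b)"
    by (simp add: eq_fract)
qed (use assms in blast)

lemma phi_tq: "phi n (tq r) = tq (r + n)"
  by (simp add: tq_def phi_Fract) (simp add: shift_poly_def)

lemma phi_add: "phi n (x + y) = phi n x + phi n y"
  by (cases x; cases y) (simp add: phi_Fract shift_poly_add shift_poly_mult)

lemma phi_mult: "phi n (x * y) = phi n x * phi n y"
  by (cases x; cases y) (simp add: phi_Fract shift_poly_mult)

lemma phi_one: "phi n 1 = 1"
  by (simp add: One_fract_def phi_Fract)

lemma phi_0: "phi 0 x = x"
  by (cases x) (simp add: phi_Fract)

lemma phi_phi: "phi m (phi n x) = phi (n + m) x"
  by (cases x) (simp add: phi_Fract shift_poly_shift_poly)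

text \<open>Trailing zeros are allowed.\<close>

definition is_partition :: "nat list \<Rightarrow> bool" where
  "is_partition lam \<longleftrightarrow> sorted_wrt (\<ge>) lam"

definition part :: "nat list \<Rightarrow> nat \<Rightarrow> nat" where
  "part lam j = (if j < length lam then lam ! j else 0)"

text \<open>
  Here \<open>N = k + 1\<close>.  Indices run from \<open>0\<close>, so the exponent \<open>\<lambda>\<^sub>j + N - j\<close> of the usual convention
  becomes \<open>part lam j + k - j\<close>.
\<close>

definition S_quot :: "nat \<Rightarrow> nat list \<Rightarrow> Qhat" where
  "S_quot k lam =
     det (mat (k + 1) (k + 1) (\<lambda>(i, j). tq (int (part lam j) + int k - int j) ^ i))
   / det (mat (k + 1) (k + 1) (\<lambda>(i, j). tq (int k - int j) ^ i))"

definition H :: "nat \<Rightarrow> int \<Rightarrow> Qhat" where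
  "H k r = (if r < 0 then 0 else S_quot k [nat r])"

text \<open>
  The Jacobi--Trudi type definition, for partitions with any number of parts.  With indices from
  \<open>0\<close>, the power \<open>\<phi>\<^bsup>1-j\<^esup>\<close> becomes \<open>phi (- j)\<close>.
\<close>

definition S :: "nat \<Rightarrow> nat list \<Rightarrow> Qhat" where
  "S k lam = det (mat (length lam) (length lam)
     (\<lambda>(i, j). phi (- int j) (H k (int (lam ! i) - int i + int j))))"

text \<open>
  The fraction field of \<open>\<rat>[t\<^sup>a | a \<in> \<rat>]\<close>.  It contains \<open>\<Union>\<^sub>r \<rat>(t\<^bsup>q^-r\<^esup>)\<close> for every
  \<open>q\<close> as a subfield, and the specialization takes values in that subfield.
\<close>

type_synonym qfield = "(rat \<Rightarrow>\<^sub>0 rat) fract"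

definition tvar :: qfield where
  "tvar = Fract (Poly_Mapping.single 1 1) 1"

definition weight :: "nat \<Rightarrow> monom_Z \<Rightarrow> rat" where
  "weight q m = (\<Sum>r\<in>Poly_Mapping.keys m. of_nat (Poly_Mapping.lookup m r) * of_nat q powi r)"

lemma weight_add: "weight q (m + n) = weight q m + weight q n"
proof -
  let ?A = "Poly_Mapping.keys m \<union> Poly_Mapping.keys n"
  have *: "weight q f = (\<Sum>r\<in>?A. of_nat (Poly_Mapping.lookup f r) * of_nat q powi r)" if "Poly_Mapping.keys f \<subseteq> ?A" for f
    unfolding weight_def using that
    by (intro sum.mono_neutral_left) (auto simp: in_keys_iff)
  show ?thesis
    using Poly_Mapping.keys_add[of m n]
    by (simp add: * lookup_add algebra_simps sum.distrib)
qed

definition spec_poly :: "nat \<Rightarrow> poly_Z \<Rightarrow> (rat \<Rightarrow>\<^sub>0 rat)" where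
  "spec_poly q = push (weight q)"

lemma spec_poly_add: "spec_poly q (f + g) = spec_poly q f + spec_poly q g"
  by (simp add: spec_poly_def push_add)

lemma spec_poly_mult: "spec_poly q (f * g) = spec_poly q f * spec_poly q g"
  by (simp add: spec_poly_def push_mult weight_add)

lemma spec_poly_one: "spec_poly q 1 = 1"
  by (simp add: spec_poly_def push_one weight_def)

lemma spec_poly_indet:
  "spec_poly q (Poly_Mapping.single (Poly_Mapping.single r 1) 1)
     = Poly_Mapping.single (of_nat q powi r) 1"
  by (simp add: spec_poly_def weight_def)

text \<open>
  Interpreting \<open>t\<^bsup>q^r\<^esup>\<close> as an actual power of \<open>t\<close> is only partially defined on \<open>Qhat\<close>: it makes
  sense on fractions having some representation whose denominator does not specialize to \<open>0\<close>.
  \<open>specializes_to q x y\<close> says that \<open>x\<close> is such a fraction and its specialization is \<open>y\<close>.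
\<close>

definition specializes_to :: "nat \<Rightarrow> Qhat \<Rightarrow> qfield \<Rightarrow> bool" where
  "specializes_to q x y \<longleftrightarrow>
     (\<exists>a b. x = Fract a b \<and> spec_poly q b \<noteq> 0 \<and> y = Fract (spec_poly q a) (spec_poly q b))"

lemma specializes_to_unique:
  assumes "specializes_to q x y" "specializes_to q x z"
  shows "y = z"
proof -
  obtain a b c d where
    ab: "x = Fract a b" "spec_poly q b \<noteq> 0" "y = Fract (spec_poly q a) (spec_poly q b)" and
    cd: "x = Fract c d" "spec_poly q d \<noteq> 0" "z = Fract (spec_poly q c) (spec_poly q d)"
    using assms unfolding specializes_to_def by blast
  have "b \<noteq> 0" "d \<noteq> 0"
    using ab cd by (auto simp: spec_poly_def)
  with ab(1) cd(1) have "a * d = c * b"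
    by (metis eq_fract(1))
  then have "spec_poly q a * spec_poly q d = spec_poly q c * spec_poly q b"
    by (metis spec_poly_mult)
  with ab cd show ?thesis
    by (simp add: eq_fract)
qed

end

theory Submission
  imports Defs
begin

text \<open>
  The Vandermonde determinant turns the quotient defining \<open>H k r\<close> into
  \<open>\<Prod>i<k. (t\<^sub>r\<^sub>+\<^sub>k - t\<^sub>i) / (t\<^sub>k - t\<^sub>i)\<close> with \<open>t\<^sub>i = tq i\<close>
  (\<open>H_product\<close>).  This is a deformed binomial coefficient, and it satisfies a Pascal recursion
  \<open>H k r = \<phi>(H (k - 1) r) + W\<^sub>k \<cdot> \<phi>(H k (r - 1))\<close>, where
  \<open>W\<^sub>k = \<Prod>i<k. (t\<^sub>k\<^sub>+\<^sub>1 - t\<^sub>i\<^sub>+\<^sub>1) / (t\<^sub>k - t\<^sub>i)\<close>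
  (\<open>hvar_pascal\<close>).  Under the specialization each factor of \<open>W\<^sub>k\<close> becomes
  \<open>(X\<^sup>q - Y\<^sup>q) / (X - Y)\<close> for two powers \<open>X\<close>, \<open>Y\<close> of \<open>t\<close>, which are distinct since \<open>q \<ge> 2\<close>.
  This is a sum of monomials.

  The recursion passes to the determinant \<open>S k lam\<close>.  Label columns by integers, column \<open>c\<close> having
  the entries \<open>\<phi>\<^sup>-\<^sup>c (H k (\<lambda>\<^sub>i - i + c))\<close>.  The recursion says that column \<open>c\<close> at level \<open>k\<close> is
  column \<open>c\<close> at level \<open>k - 1\<close> (shifted by \<open>\<phi>\<close>) plus \<open>\<phi>\<^sup>-\<^sup>c (W\<^sub>k)\<close> times column \<open>c - 1\<close> at level \<open>k\<close>.
  Expanding the last column first, a label travels downwards until it meets the label to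
  its left, where two columns coincide and the determinant vanishes.  So no signs appear:
  a determinant at level \<open>k\<close> is a combination, with products of weights as coefficients, of
  determinants at level \<open>k - 1\<close> with strictly increasing labels (\<open>column_recursion_preserves\<close>).
  Below level \<open>0\<close> the entries are Kronecker deltas and the determinants are \<open>0\<close> or \<open>1\<close>.  In the language of tableaux, the
  successive label sequences describe a column-strict filling of the diagram of \<open>\<lambda>\<close>.

  It remains to see that only nonnegative powers of \<open>\<phi>\<close> hit the weights, so that no
  fractional power of \<open>t\<close> arises.  At level \<open>k'\<close> the total shift is \<open>\<phi>\<^bsup>k-k'-c\<^esup>\<close>.  The initial labels
  are \<open>0, 1, 2, \<dots>\<close> without gaps, so at each level at most one more label becomes free to
  move: at level \<open>k'\<close> the label at position \<open>j\<close> is still \<open>j\<close> for \<open>j > k - k'\<close>, and it stays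
  there.  Labels never exceed their positions, so one that moves satisfies \<open>c \<le> k - k'\<close>.
\<close>

section \<open>Determinants as functions of their columns\<close>

text \<open>The column index comes first, so that \<open>f(j := h)\<close> replaces a whole column.\<close>

definition cdet :: "nat \<Rightarrow> (nat \<Rightarrow> nat \<Rightarrow> 'a::comm_ring_1) \<Rightarrow> 'a" where
  "cdet n f = det (mat n n (\<lambda>(i, j). f j i))"

lemma cdet_cong:
  assumes "\<And>i j. i < n \<Longrightarrow> j < n \<Longrightarrow> f j i = g j i"
  shows "cdet n f = cdet n g"
proof -
  have "mat n n (\<lambda>(i, j). f j i) = mat n n (\<lambda>(i, j). g j i)"
    using assms by (intro eq_matI) auto
  then show ?thesis by (simp add: cdet_def)
qed

text \<open>
  The cofactors along column \<open>j\<close> do not see that column, so linearity and the vanishing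
  for a zero column both follow from one coefficient vector.
\<close>

lemma cdet_expand_column:
  assumes "j < n"
  obtains C where "\<And>h. cdet n (f(j := h)) = (\<Sum>i<n. h i * C i)"
proof
  fix h
  let ?A = "\<lambda>h. mat n n (\<lambda>(i, j'). (f(j := h)) j' i)"
  have "cdet n (f(j := h)) = (\<Sum>i<n. ?A h $$ (i, j) * cofactor (?A h) i j)"
    unfolding cdet_def by (rule laplace_expansion_column) (use assms in auto)
  also have "\<dots> = (\<Sum>i<n. h i * cofactor (?A (\<lambda>_. 0)) i j)"
  proof (rule sum.cong)
    fix i assume "i \<in> {..<n}"
    moreover have "mat_delete (?A h) i j = mat_delete (?A (\<lambda>_. 0)) i j"
      using assms calculation by (auto simp: mat_delete_def intro!: eq_matI)
    ultimately show "?A h $$ (i, j) * cofactor (?A h) i j = h i * cofactor (?A (\<lambda>_. 0)) i j"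
      using assms by (simp add: cofactor_def)
  qed simp
  finally show "cdet n (f(j := h)) = (\<Sum>i<n. h i * cofactor (?A (\<lambda>_. 0)) i j)" .
qed

lemma cdet_column_linear:
  assumes "j < n"
  shows "cdet n (f(j := \<lambda>i. g i + w * h i)) = cdet n (f(j := g)) + w * cdet n (f(j := h))"
proof -
  obtain C where "\<And>h. cdet n (f(j := h)) = (\<Sum>i<n. h i * C i)"
    using cdet_expand_column[OF assms] by metis
  then show ?thesis
    by (simp add: sum.distrib sum_distrib_left algebra_simps)
qed

lemma cdet_zero_column:
  assumes "j < n" "\<And>i. i < n \<Longrightarrow> f j i = 0"
  shows "cdet n f = 0"
proof -
  obtain C where "\<And>h. cdet n (f(j := h)) = (\<Sum>i<n. h i * C i)"
    using cdet_expand_column[OF assms(1)] by metis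
  from this[of "f j"] show ?thesis using assms(2) by simp
qed

lemma cdet_equal_columns:
  fixes f :: "nat \<Rightarrow> nat \<Rightarrow> 'a::idom"
  assumes "j < n" "j' < n" "j \<noteq> j'" "\<And>i. i < n \<Longrightarrow> f j i = f j' i"
  shows "cdet n f = 0"
  unfolding cdet_def
  by (rule det_identical_columns[of _ n j j']) (use assms in auto)

text \<open>
  Left multiplication by a unitriangular matrix replaces the rows \<open>x\<^sub>j\<^sup>i\<close> by \<open>p\<^sub>i(x\<^sub>j)\<close> for the
  monic polynomials \<open>p\<^sub>i = (X - x\<^sub>0) \<cdots> (X - x\<^sub>i\<^sub>-\<^sub>1)\<close>, which vanish below the diagonal.
\<close>

lemma det_vandermonde:
  fixes x :: "nat \<Rightarrow> 'a::idom"
  shows "det (mat n n (\<lambda>(i, j). x j ^ i)) = (\<Prod>j<n. \<Prod>l<j. x j - x l)"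
proof -
  define p where "p i = (\<Prod>l<i. [:- x l, 1:])" for i
  let ?L = "mat n n (\<lambda>(i, l). coeff (p i) l)"
  let ?V = "mat n n (\<lambda>(i, j). x j ^ i)"
  let ?U = "mat n n (\<lambda>(i, j). poly (p i) (x j))"
  have deg: "degree (p i) = i" for i
    unfolding p_def by (subst degree_prod_eq_sum_degree) auto
  have lead: "coeff (p i) i = 1" for i
    using lead_coeff_prod[of "\<lambda>l. [:- x l, 1:]" "{..<i}"] deg[of i] by (simp add: p_def)
  have "?L * ?V = ?U"
  proof (rule eq_matI)
    fix i j assume "i < dim_row ?U" "j < dim_col ?U"
    then have ij: "i < n" "j < n" by auto
    have "(?L * ?V) $$ (i, j) = (\<Sum>l<n. coeff (p i) l * x j ^ l)"
      using ij by (simp add: scalar_prod_def atLeast0LessThan)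
    also have "\<dots> = (\<Sum>l\<le>i. coeff (p i) l * x j ^ l)"
      using ij deg[of i] by (intro sum.mono_neutral_right) (auto simp: coeff_eq_0)
    finally show "(?L * ?V) $$ (i, j) = ?U $$ (i, j)"
      using ij by (simp add: poly_altdef deg)
  qed auto
  then have "det ?U = det ?L * det ?V"
    using det_mult[of ?L n ?V] by simp
  moreover have "det ?L = 1"
    by (subst det_lower_triangular[of n])
       (auto simp: coeff_eq_0 deg lead diag_mat_def prod.list_conv_set_nth)
  moreover have "det ?U = (\<Prod>j<n. poly (p j) (x j))"
    by (subst det_upper_triangular[of _ n])
       (auto simp: upper_triangular_def p_def poly_prod diag_mat_def prod_zero_iff
          prod.list_conv_set_nth atLeast0LessThan)
  moreover have "poly (p j) (x j) = (\<Prod>l<j. x j - x l)" for j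
    by (simp add: p_def poly_prod)
  ultimately show ?thesis by simp
qed

section \<open>Expanding determinants by a column recursion\<close>

text \<open>
  \<open>P\<close> stands for nonnegativity, and \<open>U\<close>, \<open>V\<close> are columns of two
  consecutive levels.  The hypotheses on \<open>c\<close> record how far the labels are still packed:
  the columns from \<open>L\<close> on have no gap, so a label at a position beyond \<open>L\<close> cannot be lowered
  without meeting its left neighbour.  Hence only weights \<open>w c\<close> with \<open>c \<le> L\<close> occur, and after
  the step the labels beyond position \<open>L\<close> are unchanged.  The bound \<open>b\<close> makes the leftmost column
  vanish once its label is low enough, so that the expansion terminates.
\<close>

lemma column_recursion_preserves:
  fixes U V :: "int \<Rightarrow> nat \<Rightarrow> 'a::idom" and w :: "int \<Rightarrow> 'a"
  assumes rec: "\<And>c i. V c i = U c i + w c * V (c - 1) i"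
    and vanish: "\<And>c i. c < b \<Longrightarrow> i < l \<Longrightarrow> V c i = 0"
    and P0: "P 0" and Padd: "\<And>x y. P x \<Longrightarrow> P y \<Longrightarrow> P (x + y)"
    and Pmult: "\<And>x y. P x \<Longrightarrow> P y \<Longrightarrow> P (x * y)"
    and Pw: "\<And>c. c \<le> int L \<Longrightarrow> P (w c)"
    and PU: "\<And>d. strict_mono_on {..<l} d \<Longrightarrow> (\<And>j. j < l \<Longrightarrow> d j \<le> int j) \<Longrightarrow>
               (\<And>j. Suc L \<le> j \<Longrightarrow> j < l \<Longrightarrow> d j = int j) \<Longrightarrow> P (cdet l (\<lambda>j. U (d j)))"
    and "strict_mono_on {..<l} c" "\<And>j. j < l \<Longrightarrow> c j \<le> int j"
    and "\<And>j. L \<le> j \<Longrightarrow> j < l \<Longrightarrow> c j = int j"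
  shows "P (cdet l (\<lambda>j. V (c j)))"
proof -
  define D where "D m c = cdet l (\<lambda>j. if j < m then V (c j) else U (c j))" for m c
  \<comment> \<open>In \<open>D m c\<close> the columns from \<open>m\<close> on have been expanded already.\<close>
  define ok where "ok c \<longleftrightarrow> strict_mono_on {..<l} c \<and> (\<forall>j<l. c j \<le> int j) \<and>
     (\<forall>j. Suc L \<le> j \<longrightarrow> j < l \<longrightarrow> c j = int j)" for c :: "nat \<Rightarrow> int"
  have "P (D m c)" if "m \<le> l" "ok c" "Suc L < m \<Longrightarrow> c L = int L" for m c
    using that
  proof (induction m arbitrary: c)
    case 0
    then show ?case using PU[of c] by (auto simp: D_def ok_def)
  next
    case (Suc m)
    from Suc.prems show ?case
    proof (induction "nat (c m - b + 1)" arbitrary: c rule: less_induct)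
      case (less c)
      have ml: "m < l" using less.prems by simp
      show ?case
      proof (cases "c m < b")
        case True
        then have "D (Suc m) c = 0"
          unfolding D_def by (intro cdet_zero_column[of m]) (use ml vanish in auto)
        then show ?thesis using P0 by simp
      next
        case False
        define c' where "c' = c(m := c m - 1)"
        \<comment> \<open>Applying the recursion to column \<open>m\<close> either settles it or lowers its label by one.\<close>
        have "D (Suc m) c = cdet l ((\<lambda>j. if j < m then V (c j) else U (c j))
                 (m := \<lambda>i. U (c m) i + w (c m) * V (c m - 1) i))"
          unfolding D_def by (rule cdet_cong) (auto simp: less_Suc_eq rec[of "c m"])
        also have "\<dots> = cdet l ((\<lambda>j. if j < m then V (c j) else U (c j))(m := U (c m)))
            + w (c m) * cdet l ((\<lambda>j. if j < m then V (c j) else U (c j))(m := V (c m - 1)))"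
          by (rule cdet_column_linear[OF ml])
        also have "cdet l ((\<lambda>j. if j < m then V (c j) else U (c j))(m := U (c m))) = D m c"
          unfolding D_def by (rule cdet_cong) auto
        also have "cdet l ((\<lambda>j. if j < m then V (c j) else U (c j))(m := V (c m - 1))) = D (Suc m) c'"
          unfolding D_def by (rule cdet_cong) (auto simp: c'_def)
        finally have split: "D (Suc m) c = D m c + w (c m) * D (Suc m) c'" .
        have PD: "P (D m c)" using less.prems by (intro Suc.IH) auto
        have sm: "c i < c j" if "i < j" "j < l" for i j
          using less.prems(2) that by (auto simp: ok_def strict_mono_on_def)
        show ?thesis
        proof (cases "m > 0 \<and> c (m - 1) = c m - 1")
          case True
          then have "D (Suc m) c' = 0"
            unfolding D_def by (intro cdet_equal_columns[of m l "m - 1"])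
              (use ml in \<open>auto simp: c'_def\<close>)
          with split PD show ?thesis by simp
        next
          case gap: False
          have "m \<le> L"
          proof (rule ccontr)
            assume "\<not> m \<le> L"
            then have "c m = int m"
              using less.prems(2) ml by (simp add: ok_def)
            moreover have "c (m - 1) = int (m - 1)"
            proof (cases "m - 1 = L")
              case True
              with less.prems(3) \<open>\<not> m \<le> L\<close> show ?thesis by simp
            next
              case False
              with less.prems(2) ml \<open>\<not> m \<le> L\<close> show ?thesis by (simp add: ok_def)
            qed
            ultimately show False using gap \<open>\<not> m \<le> L\<close> by auto
          qed
          have "strict_mono_on {..<l} c'"
            unfolding strict_mono_on_def
          proof (intro allI impI, goal_cases)
            case (1 i j)
            then have ij: "i < j" "j < l" by auto
            have "c i < c m - 1" if "j = m"
            proof -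
              have "c (m - 1) < c m - 1" using sm[of "m - 1" m] gap ij ml that by auto
              moreover have "c i \<le> c (m - 1)" using sm[of i "m - 1"] ij that
                by (cases "i = m - 1") (auto intro!: less_imp_le)
              ultimately show ?thesis by simp
            qed
            with sm[of i j] ij show ?case by (auto simp: c'_def)
          qed
          moreover have "c' j \<le> int j" if "j < l" for j
          proof -
            have "c' j \<le> c j" by (simp add: c'_def)
            also have "c j \<le> int j" using less.prems(2) that by (simp add: ok_def)
            finally show ?thesis .
          qed
          moreover have "c' j = int j" if "Suc L \<le> j" "j < l" for j
            using less.prems(2) that \<open>m \<le> L\<close> by (simp add: ok_def c'_def)
          ultimately have "ok c'" by (simp add: ok_def)
          moreover have "nat (c' m - b + 1) < nat (c m - b + 1)" using False by (simp add: c'_def)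
          ultimately have "P (D (Suc m) c')"
            using less.hyps[of c'] less.prems(1) \<open>m \<le> L\<close> by auto
          moreover have "P (w (c m))"
          proof (rule Pw)
            have "c m \<le> int m" using less.prems(2) ml by (auto simp: ok_def)
            with \<open>m \<le> L\<close> show "c m \<le> int L" by simp
          qed
          ultimately show ?thesis using split PD Padd Pmult by simp
        qed
      qed
    qed
  qed
  moreover have "ok c" using assms(8,9,10) by (simp add: ok_def)
  ultimately have "P (D l c)" using assms(10) by simp
  also have "D l c = cdet l (\<lambda>j. V (c j))" unfolding D_def by (rule cdet_cong) auto
  finally show ?thesis .
qed

text \<open>
  If every \<open>c j\<close> is some \<open>b i\<close>, then the two sequences enumerate the same set increasingly, so
  they agree and the matrix is the identity.  Otherwise it has a zero column.
\<close>

lemma cdet_incidence_cases: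
  fixes b c :: "nat \<Rightarrow> int"
  assumes b: "strict_mono_on {..<l} b" and c: "strict_mono_on {..<l} c"
  shows "cdet l (\<lambda>j i. if b i = c j then 1 else 0 :: 'a::idom) \<in> {0, 1}"
proof (cases "c ` {..<l} \<subseteq> b ` {..<l}")
  case True
  have inj: "inj_on b {..<l}" "inj_on c {..<l}"
    using b c by (auto intro: strict_mono_on_imp_inj_on)
  have "c ` {..<l} = b ` {..<l}"
    using True inj by (intro card_subset_eq) (auto simp: card_image)
  then have "map c [0..<l] = map b [0..<l]"
    using inj b c
    by (intro sorted_distinct_set_unique)
       (auto simp: distinct_map atLeast0LessThan sorted_map sorted_wrt_iff_nth_less
          strict_mono_on_def less_imp_le)
  then have cb: "c j = b j" if "j < l" for j using that by simp
  have "mat l l (\<lambda>(i, j). if b i = c j then 1 else 0 :: 'a) = 1\<^sub>m l"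
    using inj cb by (intro eq_matI) (auto simp: inj_on_def)
  then show ?thesis by (simp add: cdet_def)
next
  case False
  then obtain j where j: "j < l" "c j \<notin> b ` {..<l}" by blast
  then have "cdet l (\<lambda>j i. if b i = c j then 1 else 0 :: 'a) = 0"
    by (intro cdet_zero_column[of j]) (force+)
  then show ?thesis by simp
qed

section \<open>The complete homogeneous functions\<close>

lemma single_one_eq_iff:
  "Poly_Mapping.single a (1 :: 'b::zero_neq_one) = Poly_Mapping.single b 1 \<longleftrightarrow> a = b"
proof
  assume "Poly_Mapping.single a (1 :: 'b) = Poly_Mapping.single b 1"
  then have "Poly_Mapping.keys (Poly_Mapping.single a (1 :: 'b)) =
      Poly_Mapping.keys (Poly_Mapping.single b (1 :: 'b))" by (rule arg_cong)
  then show "a = b" by (simp add: keys_single)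
qed simp

lemma Fract_1_eq_iff: "Fract a 1 = Fract b 1 \<longleftrightarrow> a = b"
  by (simp add: eq_fract(1))

lemma tq_eq_iff [simp]: "tq a = tq b \<longleftrightarrow> a = b"
  unfolding tq_def Fract_1_eq_iff single_one_eq_iff ..

lemma phi_zero: "phi a 0 = 0"
  using phi_add[of a 0 0] by (simp only: add_0_left add_cancel_right_right)

lemma phi_diff: "phi a (x - y) = phi a x - phi a y"
  using phi_add[of a "x - y" y] by (simp add: algebra_simps)

lemma phi_divide: "phi a (x / y) = phi a x / phi a y"
proof (cases "y = 0")
  case False
  have "phi a y \<noteq> 0"
  proof
    assume "phi a y = 0"
    then have "phi (- a) (phi a y) = 0" by (simp add: phi_zero)
    with False show False by (simp add: phi_phi phi_0)
  qed
  then show ?thesis using phi_mult[of a "x / y" y] False by (simp add: field_simps)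
qed (simp add: phi_zero)

lemma phi_prod: "phi a (\<Prod>i\<in>I. f i) = (\<Prod>i\<in>I. phi a (f i))"
  by (induction I rule: infinite_finite_induct) (simp_all add: phi_one phi_mult)

text \<open>
  The two Vandermonde determinants have all nodes in common except the one of column \<open>0\<close>, so
  only the factors involving that node survive in the quotient.
\<close>

lemma H_product:
  assumes "m \<ge> 0"
  shows "H k m = (\<Prod>i<k. (tq (m + int k) - tq (int i)) / (tq (int k) - tq (int i)))"
proof -
  define x where "x r j = tq ((if j = 0 then r else 0) + int k - int j)" for r and j :: nat
  have "mat (k + 1) (k + 1) (\<lambda>(i, j). tq (int (part [nat m] j) + int k - int j) ^ i)
      = mat (k + 1) (k + 1) (\<lambda>(i, j). x m j ^ i)"
    using assms by (intro eq_matI) (auto simp: x_def part_def)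
  moreover have "mat (k + 1) (k + 1) (\<lambda>(i, j). tq (int k - int j) ^ i)
      = mat (k + 1) (k + 1) (\<lambda>(i, j). x 0 j ^ i)"
    by (intro eq_matI) (auto simp: x_def)
  ultimately have "H k m = (\<Prod>j<Suc k. \<Prod>l<j. x m j - x m l) / (\<Prod>j<Suc k. \<Prod>l<j. x 0 j - x 0 l)"
    using assms by (simp only: H_def S_quot_def det_vandermonde) simp
  moreover have "(\<Prod>j<Suc k. \<Prod>l<j. x r j - x r l) =
     (\<Prod>j<k. tq (int k - int (Suc j)) - tq (r + int k)) *
     (\<Prod>j<k. \<Prod>l<j. tq (int k - int (Suc j)) - tq (int k - int (Suc l)))" for r
    by (simp only: prod.lessThan_Suc_shift) (simp add: x_def prod.distrib)
  moreover have "(\<Prod>j<k. \<Prod>l<j. tq (int k - int (Suc j)) - tq (int k - int (Suc l))) \<noteq> 0"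
    by (auto simp: prod_zero_iff)
  ultimately have "H k m = (\<Prod>j<k. (tq (int k - int (Suc j)) - tq (m + int k)) /
                                    (tq (int k - int (Suc j)) - tq (int k)))"
    by (simp add: prod_dividef)
  also have "\<dots> = (\<Prod>j<k. (tq (m + int k) - tq (int (k - Suc j))) /
                         (tq (int k) - tq (int (k - Suc j))))"
  proof (rule prod.cong)
    fix j assume "j \<in> {..<k}"
    then have "int k - int (Suc j) = int (k - Suc j)" by auto
    then show "(tq (int k - int (Suc j)) - tq (m + int k)) / (tq (int k - int (Suc j)) - tq (int k)) =
       (tq (m + int k) - tq (int (k - Suc j))) / (tq (int k) - tq (int (k - Suc j)))"
      using minus_divide_divide[of "tq (m + int k) - tq (int (k - Suc j))"
          "tq (int k) - tq (int (k - Suc j))"] by (simp only: minus_diff_eq)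
  qed simp
  also have "\<dots> = (\<Prod>i<k. (tq (m + int k) - tq (int i)) / (tq (int k) - tq (int i)))"
    by (rule prod.nat_diff_reindex)
  finally show ?thesis .
qed

lemma phi_H_product:
  "m \<ge> 0 \<Longrightarrow> phi a (H k m) =
     (\<Prod>i<k. (tq (m + int k + a) - tq (int i + a)) / (tq (int k + a) - tq (int i + a)))"
  by (simp add: H_product phi_prod phi_divide phi_diff phi_tq)

text \<open>
  The polynomial \<open>\<Prod>i<k. t\<^sub>k - t\<^sub>i\<close>, shifted by \<open>\<phi>\<^bsup>a+1\<^esup>\<close>, divided by its shift by \<open>\<phi>\<^sup>a\<close>.
\<close>

definition pascal_weight :: "nat \<Rightarrow> int \<Rightarrow> Qhat" where
  "pascal_weight k a =
     (\<Prod>i<k. (tq (int k + a + 1) - tq (int i + a + 1)) / (tq (int k + a) - tq (int i + a)))"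

text \<open>
  The first argument counts the variables \<open>1, t, \<dots>\<close>, and the second is the exponent of \<open>\<phi>\<close>.
  Starting from no variables at all, instead of from \<open>H 0\<close>, makes the recursion end in
  Kronecker deltas.
\<close>

fun hvar :: "nat \<Rightarrow> int \<Rightarrow> int \<Rightarrow> Qhat" where
  "hvar 0 a m = (if m = 0 then 1 else 0)"
| "hvar (Suc k) a m = phi a (H k m)"

lemma hvar_negative: "m < 0 \<Longrightarrow> hvar n a m = 0"
  by (cases n) (auto simp: H_def phi_zero)

text \<open>
  For \<open>m \<ge> 0\<close>, \<open>n \<ge> 1\<close>, and up to the shift by \<open>a\<close>: with \<open>x = t\<^sub>m\<^sub>+\<^sub>n\<close>, both terms on the right are multiples of \<open>A / B\<close>, where \<open>A\<close> and \<open>B\<close> are the products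
  over \<open>0 < i < n\<close> of \<open>x - t\<^sub>i\<close> and \<open>t\<^sub>n - t\<^sub>i\<close>, and the
  recursion reduces to \<open>(x - t\<^sub>0) / (t\<^sub>n - t\<^sub>0) = 1 + (x - t\<^sub>n) / (t\<^sub>n - t\<^sub>0)\<close>.
\<close>

lemma hvar_pascal:
  "hvar (Suc n) a m = hvar n (a + 1) m + pascal_weight n a * hvar (Suc n) (a + 1) (m - 1)"
proof -
  consider "m < 0" | "m \<ge> 0" "n = 0" | k where "m \<ge> 0" "n = Suc k"
    using not_less by (cases n) blast+
  then show ?thesis
  proof cases
    case 1
    then show ?thesis by (simp add: hvar_negative del: hvar.simps)
  next
    case 2
    have "phi a' (H 0 m') = (if m' < 0 then 0 else 1)" for a' m'
      using phi_H_product[of m' a' 0] hvar_negative[of m' "Suc 0" a'] by simp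
    with 2 show ?thesis by (simp add: pascal_weight_def)
  next
    case (3 k)
    define x where "x = tq (m + int n + a)"
    define y where "y i = tq (int i + a)" for i
    have y: "y i = y j \<longleftrightarrow> i = j" for i j by (simp add: y_def)
    have y': "tq (int i + (a + 1)) = y (Suc i)" "tq (int i + a + 1) = y (Suc i)" for i
      by (simp_all add: y_def algebra_simps)
    have low: "hvar (Suc n) a m = (\<Prod>i<n. (x - y i) / (y n - y i))"
      using 3 by (simp add: phi_H_product x_def y_def)
    have mid: "hvar n (a + 1) m = (\<Prod>i<k. (x - y (Suc i)) / (y n - y (Suc i)))"
    proof -
      have "m + int k + (a + 1) = m + int n + a" using 3 by simp
      then show ?thesis
        using 3 by (simp only: hvar.simps phi_H_product y') (simp add: x_def)
    qed
    have high: "pascal_weight n a * hvar (Suc n) (a + 1) (m - 1)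
        = (\<Prod>i<n. (x - y (Suc i)) / (y n - y i))"
    proof (cases "m = 0")
      case True
      then have "x = y (Suc k)" using 3 by (simp add: x_def y_def)
      then have "(\<Prod>i<n. (x - y (Suc i)) / (y n - y i)) = 0"
        using 3 by auto
      with True show ?thesis by (simp add: hvar_negative del: hvar.simps)
    next
      case False
      have "m - 1 + int n + (a + 1) = m + int n + a" by simp
      with False 3(1) have "hvar (Suc n) (a + 1) (m - 1)
          = (\<Prod>i<n. (x - y (Suc i)) / (y (Suc n) - y (Suc i)))"
        by (simp only: hvar.simps phi_H_product y') (simp add: x_def phi_H_product y')
      moreover have "pascal_weight n a = (\<Prod>i<n. (y (Suc n) - y (Suc i)) / (y n - y i))"
        by (simp only: pascal_weight_def y' y_def[symmetric])
      moreover have "y (Suc n) - y (Suc i) \<noteq> 0" if "i < n" for i using that y by simp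
      ultimately show ?thesis
        by (simp add: prod.distrib[symmetric] del: hvar.simps)
    qed
    define A where "A = (\<Prod>i<k. x - y (Suc i))"
    define B where "B = (\<Prod>i<k. y n - y (Suc i))"
    have "B \<noteq> 0" using y 3 by (simp add: B_def prod_zero_iff)
    moreover have "y n - y 0 \<noteq> 0" using y 3 by simp
    moreover have "(\<Prod>i<n. x - y i) = (x - y 0) * A"
      unfolding 3(2) A_def by (rule prod.lessThan_Suc_shift)
    moreover have "(\<Prod>i<n. x - y (Suc i)) = A * (x - y n)"
      unfolding 3(2) A_def by simp
    moreover have "(\<Prod>i<n. y n - y i) = (y n - y 0) * B"
      unfolding B_def by (subst 3(2), rule prod.lessThan_Suc_shift)
    ultimately show ?thesis
      unfolding low mid high prod_dividef A_def[symmetric] B_def[symmetric]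
      by (simp only:) (simp add: field_simps)
  qed
qed

section \<open>Nonnegativity of specializations\<close>

definition nonneg_values :: "qfield set" where
  "nonneg_values = {poly (map_poly of_int p) tvar | p :: int poly. \<forall>i. coeff p i \<ge> 0}"

lemma nonneg_values_of_nat: "of_nat n \<in> nonneg_values"
proof -
  have "poly (map_poly of_int [:int n:]) tvar = of_nat n"
    by (simp add: map_poly_pCons)
  moreover have "\<forall>i. coeff [:int n:] i \<ge> 0" by (simp add: coeff_pCons split: nat.splits)
  ultimately show ?thesis unfolding nonneg_values_def
    by (intro CollectI exI[of _ "[:int n:]"]) simp
qed

lemma nonneg_values_tvar: "tvar \<in> nonneg_values"
proof -
  have "poly (map_poly of_int [:0, 1:]) tvar = tvar"
    by (simp add: map_poly_pCons)
  moreover have "\<forall>i. coeff [:0, 1::int:] i \<ge> 0" by (simp add: coeff_pCons split: nat.splits)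
  ultimately show ?thesis unfolding nonneg_values_def
    by (intro CollectI exI[of _ "[:0, 1:]"]) simp
qed

lemma nonneg_values_add: "x \<in> nonneg_values \<Longrightarrow> y \<in> nonneg_values \<Longrightarrow> x + y \<in> nonneg_values"
proof -
  assume "x \<in> nonneg_values" "y \<in> nonneg_values"
  then obtain p r :: "int poly" where p: "\<forall>i. coeff p i \<ge> 0" "x = poly (map_poly of_int p) tvar"
    and r: "\<forall>i. coeff r i \<ge> 0" "y = poly (map_poly of_int r) tvar"
    unfolding nonneg_values_def by blast
  have "x + y = poly (map_poly of_int (p + r)) tvar"
    unfolding p(2) r(2) poly_add[symmetric]
    by (rule arg_cong[where f = "\<lambda>p. poly p tvar"]) (simp add: poly_eq_iff coeff_map_poly)
  moreover have "\<forall>i. coeff (p + r) i \<ge> 0" using p r by simp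
  ultimately show ?thesis unfolding nonneg_values_def by blast
qed

lemma nonneg_values_mult: "x \<in> nonneg_values \<Longrightarrow> y \<in> nonneg_values \<Longrightarrow> x * y \<in> nonneg_values"
proof -
  assume "x \<in> nonneg_values" "y \<in> nonneg_values"
  then obtain p r :: "int poly" where p: "\<forall>i. coeff p i \<ge> 0" "x = poly (map_poly of_int p) tvar"
    and r: "\<forall>i. coeff r i \<ge> 0" "y = poly (map_poly of_int r) tvar"
    unfolding nonneg_values_def by blast
  have "x * y = poly (map_poly of_int (p * r)) tvar"
    unfolding p(2) r(2) poly_mult[symmetric]
    by (rule arg_cong[where f = "\<lambda>p. poly p tvar"])
       (simp add: poly_eq_iff coeff_map_poly coeff_mult)
  moreover have "\<forall>i. coeff (p * r) i \<ge> 0" using p r by (simp add: coeff_mult sum_nonneg)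
  ultimately show ?thesis unfolding nonneg_values_def by blast
qed

lemma nonneg_values_power: "x \<in> nonneg_values \<Longrightarrow> x ^ n \<in> nonneg_values"
  using nonneg_values_of_nat[of 1] by (induction n) (auto intro: nonneg_values_mult)

lemma nonneg_values_sum: "(\<And>i. i \<in> A \<Longrightarrow> f i \<in> nonneg_values) \<Longrightarrow> sum f A \<in> nonneg_values"
  using nonneg_values_of_nat[of 0]
  by (induction A rule: infinite_finite_induct) (auto intro: nonneg_values_add)

lemma spec_poly_0: "spec_poly q 0 = 0"
  by (simp add: spec_poly_def)

lemma specializes_to_Fract_1: "specializes_to q (Fract a 1) (Fract (spec_poly q a) 1)"
  unfolding specializes_to_def by (intro exI[of _ a] exI[of _ 1]) (simp add: spec_poly_one)

lemma spec_poly_minus: "spec_poly q (- f) = - spec_poly q f"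
  using spec_poly_add[of q f "- f"] by (simp add: spec_poly_0 eq_neg_iff_add_eq_0 add.commute)

lemma specializes_to_0: "specializes_to q 0 0"
  and specializes_to_1: "specializes_to q 1 1"
  using specializes_to_Fract_1[of q 0] specializes_to_Fract_1[of q 1]
  by (simp_all add: spec_poly_0 spec_poly_one Zero_fract_def One_fract_def)

lemma specializes_to_add:
  assumes "specializes_to q x x'" "specializes_to q y y'"
  shows "specializes_to q (x + y) (x' + y')"
proof -
  obtain a b c d where
    ab: "x = Fract a b" "spec_poly q b \<noteq> 0" "x' = Fract (spec_poly q a) (spec_poly q b)" and
    cd: "y = Fract c d" "spec_poly q d \<noteq> 0" "y' = Fract (spec_poly q c) (spec_poly q d)"
    using assms unfolding specializes_to_def by blast
  from ab cd have "b \<noteq> 0" "d \<noteq> 0" by (auto simp: spec_poly_0)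
  with ab cd show ?thesis unfolding specializes_to_def
    by (intro exI[of _ "a * d + c * b"] exI[of _ "b * d"]) (simp add: spec_poly_mult spec_poly_add)
qed

lemma specializes_to_diff:
  assumes "specializes_to q x x'" "specializes_to q y y'"
  shows "specializes_to q (x - y) (x' - y')"
proof -
  have "specializes_to q (- y) (- y')"
    using assms(2) unfolding specializes_to_def by (metis minus_fract spec_poly_minus)
  from specializes_to_add[OF assms(1) this] show ?thesis by simp
qed

lemma specializes_to_mult:
  assumes "specializes_to q x x'" "specializes_to q y y'"
  shows "specializes_to q (x * y) (x' * y')"
proof -
  obtain a b c d where
    ab: "x = Fract a b" "spec_poly q b \<noteq> 0" "x' = Fract (spec_poly q a) (spec_poly q b)" and
    cd: "y = Fract c d" "spec_poly q d \<noteq> 0" "y' = Fract (spec_poly q c) (spec_poly q d)"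
    using assms unfolding specializes_to_def by blast
  with ab cd show ?thesis unfolding specializes_to_def
    by (intro exI[of _ "a * c"] exI[of _ "b * d"]) (simp add: spec_poly_mult)
qed

lemma specializes_to_inverse:
  assumes "specializes_to q x x'" "x' \<noteq> 0"
  shows "specializes_to q (inverse x) (inverse x')"
proof -
  obtain a b where
    ab: "x = Fract a b" "spec_poly q b \<noteq> 0" "x' = Fract (spec_poly q a) (spec_poly q b)"
    using assms unfolding specializes_to_def by blast
  with assms(2) have "spec_poly q a \<noteq> 0" by (auto simp: fract_collapse)
  with ab show ?thesis unfolding specializes_to_def
    by (intro exI[of _ b] exI[of _ a]) simp
qed

lemma tvar_power: "tvar ^ n = Fract (Poly_Mapping.single (of_nat n) 1) 1"
  by (induction n) (simp_all add: tvar_def One_fract_def mult_single add.commute)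

lemma tvar_power_eq_iff: "tvar ^ m = tvar ^ n \<longleftrightarrow> m = n"
  unfolding tvar_power Fract_1_eq_iff single_one_eq_iff of_nat_eq_iff ..

lemma specializes_to_tq: "specializes_to q (tq (int n)) (tvar ^ (q ^ n))"
  using specializes_to_Fract_1[of q "Poly_Mapping.single (Poly_Mapping.single (int n) 1) 1"]
  by (simp only: tq_def spec_poly_indet tvar_power power_int_of_nat of_nat_power)

definition nonneg_specialization :: "nat \<Rightarrow> Qhat \<Rightarrow> bool" where
  "nonneg_specialization q x \<longleftrightarrow> (\<exists>y \<in> nonneg_values. specializes_to q x y)"

lemma nonneg_specialization_0: "nonneg_specialization q 0"
  and nonneg_specialization_1: "nonneg_specialization q 1"
  using nonneg_values_of_nat[of 0] specializes_to_0 nonneg_values_of_nat[of 1] specializes_to_1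
  by (auto simp: nonneg_specialization_def)

lemma nonneg_specialization_add:
  "nonneg_specialization q x \<Longrightarrow> nonneg_specialization q y \<Longrightarrow> nonneg_specialization q (x + y)"
  unfolding nonneg_specialization_def using nonneg_values_add specializes_to_add by blast

lemma nonneg_specialization_mult:
  "nonneg_specialization q x \<Longrightarrow> nonneg_specialization q y \<Longrightarrow> nonneg_specialization q (x * y)"
  unfolding nonneg_specialization_def using nonneg_values_mult specializes_to_mult by blast

lemma nonneg_specialization_prod:
  "(\<And>i. i \<in> A \<Longrightarrow> nonneg_specialization q (f i)) \<Longrightarrow> nonneg_specialization q (prod f A)"
  by (induction A rule: infinite_finite_induct)
     (auto intro: nonneg_specialization_mult nonneg_specialization_1)

text \<open>
  With \<open>X\<close> and \<open>Y\<close> the specializations in the denominator, the quotient becomes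
  \<open>(X\<^sup>q - Y\<^sup>q) / (X - Y)\<close>, a sum of products of powers of \<open>X\<close> and \<open>Y\<close>.
\<close>

lemma nonneg_specialization_frobenius_quotient:
  assumes "q \<ge> 2" "m < n"
  shows "nonneg_specialization q ((tq (int n + 1) - tq (int m + 1)) / (tq (int n) - tq (int m)))"
proof -
  define X where "X = tvar ^ (q ^ n)"
  define Y where "Y = tvar ^ (q ^ m)"
  \<comment> \<open>For \<open>q = 1\<close> the denominator would specialize to \<open>0\<close>.\<close>
  have "X - Y \<noteq> 0"
    using assms by (simp add: X_def Y_def tvar_power_eq_iff power_inject_exp)
  have "specializes_to q (tq (int n + 1)) (X ^ q)" "specializes_to q (tq (int m + 1)) (Y ^ q)"
    using specializes_to_tq[of q "Suc n"] specializes_to_tq[of q "Suc m"]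
    by (simp_all add: X_def Y_def power_mult[symmetric] mult.commute add.commute)
  moreover have "specializes_to q (tq (int n) - tq (int m)) (X - Y)"
    unfolding X_def Y_def by (intro specializes_to_diff specializes_to_tq)
  ultimately have "specializes_to q ((tq (int n + 1) - tq (int m + 1)) / (tq (int n) - tq (int m)))
      ((X ^ q - Y ^ q) / (X - Y))"
    using \<open>X - Y \<noteq> 0\<close> unfolding divide_inverse
    by (metis specializes_to_mult specializes_to_inverse specializes_to_diff)
  also have "(X ^ q - Y ^ q) / (X - Y) = (\<Sum>i<q. Y ^ (q - Suc i) * X ^ i)"
    using \<open>X - Y \<noteq> 0\<close> by (simp add: power_diff_sumr2)
  finally show ?thesis unfolding nonneg_specialization_def X_def Y_def
    by (rule bexI)
       (intro nonneg_values_sum nonneg_values_mult nonneg_values_power nonneg_values_tvar)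
qed

lemma nonneg_specialization_pascal_weight:
  assumes "q \<ge> 2" "a \<ge> 0"
  shows "nonneg_specialization q (pascal_weight k a)"
  unfolding pascal_weight_def
proof (rule nonneg_specialization_prod)
  fix i assume "i \<in> {..<k}"
  then show "nonneg_specialization q
      ((tq (int k + a + 1) - tq (int i + a + 1)) / (tq (int k + a) - tq (int i + a)))"
    using nonneg_specialization_frobenius_quotient[OF assms(1), of "i + nat a" "k + nat a"] assms(2)
    by simp
qed

section \<open>Nonnegativity of the Schur determinants\<close>

text \<open>
  Induction on the number \<open>n\<close> of variables that are left, starting in the theorem from
  \<open>n = k + 1\<close> and \<open>c j = j\<close>.  The shift \<open>k + 1 - n - c\<close> is chosen such that the recursion
  between levels \<open>n + 1\<close> and \<open>n\<close> becomes the column recursion with weights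
  \<open>pascal_weight n (k - n - c)\<close>, which for \<open>c \<le> k - n\<close> involve no fractional power of \<open>t\<close>.
\<close>

lemma nonneg_specialization_jacobi_trudi:
  fixes lam :: "nat list" and k q n :: nat
  defines "F \<equiv> \<lambda>n c i. hvar n (int k + 1 - int n - c) (int (lam ! i) - int i + c)"
  assumes "is_partition lam" "q \<ge> 2" "n \<le> Suc k"
    and "strict_mono_on {..<length lam} c" "\<And>j. j < length lam \<Longrightarrow> c j \<le> int j"
    and "\<And>j. Suc k - n \<le> j \<Longrightarrow> j < length lam \<Longrightarrow> c j = int j"
  shows "nonneg_specialization q (cdet (length lam) (\<lambda>j. F n (c j)))"
  using assms(4-)
proof (induction n arbitrary: c)
  case 0
  define b where "b i = int i - int (lam ! i)" for i
  have "strict_mono_on {..<length lam} b"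
  proof (rule strict_mono_onI)
    fix i j assume "i \<in> {..<length lam}" "j \<in> {..<length lam}" "i < j"
    then have "lam ! j \<le> lam ! i"
      using assms(2) by (simp add: is_partition_def sorted_wrt_iff_nth_less)
    with \<open>i < j\<close> show "b i < b j" by (simp add: b_def)
  qed
  then have "cdet (length lam) (\<lambda>j i. if b i = c j then 1 else 0 :: Qhat) \<in> {0, 1}"
    by (rule cdet_incidence_cases) (rule 0(2))
  moreover have "cdet (length lam) (\<lambda>j. F 0 (c j))
      = cdet (length lam) (\<lambda>j i. if b i = c j then 1 else 0)"
    by (rule cdet_cong) (auto simp: F_def b_def)
  ultimately show ?case
    using nonneg_specialization_0[of q] nonneg_specialization_1[of q] by (elim insertE) simp_all
next
  case (Suc n)
  show ?case
  proof (rule column_recursion_preserves[where P = "nonneg_specialization q" and l = "length lam"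
      and U = "F n" and V = "F (Suc n)" and c = c and L = "k - n" and b = "- int (sum_list lam)"
      and w = "\<lambda>c. pascal_weight n (int k - int n - c)"])
    fix c i
    have args: "int k + 1 - int (Suc n) - c = int k - int n - c"
      "int k + 1 - int n - c = int k - int n - c + 1"
      "int k + 1 - int (Suc n) - (c - 1) = int k - int n - c + 1"
      "int (lam ! i) - int i + (c - 1) = int (lam ! i) - int i + c - 1" by auto
    show "F (Suc n) c i = F n c i + pascal_weight n (int k - int n - c) * F (Suc n) (c - 1) i"
      unfolding F_def args by (rule hvar_pascal)
  next
    fix c i
    assume "c < - int (sum_list lam)" "i < length lam"
    moreover have "lam ! i \<le> sum_list lam"
      using calculation by (simp add: elem_le_sum_list)
    ultimately show "F (Suc n) c i = 0"
      unfolding F_def by (intro hvar_negative) linarith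
  next
    fix c assume "c \<le> int (k - n)"
    then show "nonneg_specialization q (pascal_weight n (int k - int n - c))"
      using Suc.prems(1) by (intro nonneg_specialization_pascal_weight assms) auto
  next
    fix d :: "nat \<Rightarrow> int"
    assume "strict_mono_on {..<length lam} d" "\<And>j. j < length lam \<Longrightarrow> d j \<le> int j"
      "\<And>j. Suc (k - n) \<le> j \<Longrightarrow> j < length lam \<Longrightarrow> d j = int j"
    then show "nonneg_specialization q (cdet (length lam) (\<lambda>j. F n (d j)))"
      using Suc.prems(1) by (intro Suc.IH) (auto simp: Suc_diff_le)
  next
    show "nonneg_specialization q 0" by (rule nonneg_specialization_0)
  next
    show "nonneg_specialization q (x + y)"
      if "nonneg_specialization q x" "nonneg_specialization q y" for x y
      using that by (rule nonneg_specialization_add)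
  next
    show "nonneg_specialization q (x * y)"
      if "nonneg_specialization q x" "nonneg_specialization q y" for x y
      using that by (rule nonneg_specialization_mult)
  next
    show "strict_mono_on {..<length lam} c" by (rule Suc.prems(2))
  next
    show "c j \<le> int j" if "j < length lam" for j
      using that by (rule Suc.prems(3))
  next
    show "c j = int j" if "k - n \<le> j" "j < length lam" for j
      using that by (intro Suc.prems(4)) auto
  qed
qed

theorem corollary6p7:
  fixes lam :: "nat list" and k q :: nat
  assumes "is_partition lam" and "q \<ge> 2"
  shows "\<exists>p :: int poly. (\<forall>i. coeff p i \<ge> 0) \<and>
           specializes_to q (S k lam) (poly (map_poly of_int p) tvar)"
proof -
  have "S k lam = cdet (length lam)
      (\<lambda>j i. hvar (Suc k) (int k + 1 - int (Suc k) - int j) (int (lam ! i) - int i + int j))"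
    by (simp add: S_def cdet_def)
  moreover have "nonneg_specialization q \<dots>"
    by (rule nonneg_specialization_jacobi_trudi[OF assms]) (auto simp: strict_mono_on_def)
  ultimately show ?thesis
    by (auto simp: nonneg_specialization_def nonneg_values_def)
qed

end
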